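(* Let $H$ be a realizable 3-uniform hypergraph and let $T$ be a realization of $H$. Then $H$ and $T$ share the same strong modules, i.e. a subset of $V(H)=V(T)$ is a strong module of $H$ if and only if it is a strong module of $T$.
   Context: All structures are finite. A 3-uniform hypergraph $H$ consists of a vertex set $V(H)$ and an edge set $E(H)\subseteq\binom{V(H)}{3}$. A tournament $T$ has a vertex set $V(T)$ and an arc set $A(T)$ such that for distinct $v,w\in V(T)$ exactly one of $vw,wv$ belongs to $A(T)$ (and there are no loops). A 3-cycle is a tournament on three vertices isomorphic to $(\{0,1,2\},\{01,12,20\})$. The $C_3$-structure $C_3(T)$ of a tournament $T$ is the 3-uniform hypergraph on $V(T)$ whose edges are the 3-element subsets $X$ of $V(T)$ such that $T[X]$ is a 3-cycle. A tournament $T$ with $V(T)=V(H)$ is a realization of $H$ if $H=C_3(T)$; $H$ is realizable if it admits a realization. A subset $M$ of $V(H)$ is a module of the hypergraph $H$ if for each $e\in E(H)$ such that $e\cap M\neq\emptyset$ and $e\setminus M\neq\emptyset$, there exists $m\in M$ such that $e\cap M=\{m\}$ and for every $n\in M$, $(e\setminus\{m\})\cup\{n\}\in E(H)$. A subset $M$ of $V(T)$ is a module of the tournament $T$ if for any $x,y\in M$ and $v\in V(T)$, if $xv,vy\in A(T)$, then $v\in M$. A module $M$ of $H$ (resp. $T$) is strong if for every module $N$ of $H$ (resp. $T$) with $M\cap N\neq\emptyset$, we have $M\subseteq N$ or $N\subseteq M$. *)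

theory Defs
  imports "Graph_Theory.Graph_Theory"
begin

section \<open>Hypergraphs and tournaments\<close>

record 'a hypergraph =
  hverts :: "'a set"
  hedges :: "'a set set"

locale uniform3_hypergraph =
  fixes H :: "'a hypergraph"
  assumes finite_hverts: "finite (hverts H)"
    and hedge_subset: "e \<in> hedges H \<Longrightarrow> e \<subseteq> hverts H"
    and hedge_card: "e \<in> hedges H \<Longrightarrow> card e = 3"

text \<open>\<^locale>\<open>pair_digraph\<close> already provides finiteness, arcs between vertices, and the
  absence of loops.\<close>
locale tournament = pair_digraph T for T :: "'a pair_pre_digraph" +
  assumes exactly_one_arc:
    "\<lbrakk>v \<in> pverts T; w \<in> pverts T; v \<noteq> w\<rbrakk> \<Longrightarrow> ((v, w) \<in> parcs T) \<noteq> ((w, v) \<in> parcs T)"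


section \<open>The $C_3$-structure of a tournament\<close>

definition std_cycle3 :: "nat pair_pre_digraph" where
  "std_cycle3 = \<lparr>pverts = {0, 1, 2}, parcs = {(0, 1), (1, 2), (2, 0)}\<rparr>"

text \<open>A digraph isomorphic to \<^const>\<open>std_cycle3\<close> is a tournament on three vertices, so
  this need not be required separately.\<close>
definition is_cycle3 :: "('a, 'b) pre_digraph \<Rightarrow> bool" where
  "is_cycle3 G \<longleftrightarrow> digraph_iso G (with_proj std_cycle3)"

definition C3_structure :: "'a pair_pre_digraph \<Rightarrow> 'a hypergraph" where
  "C3_structure T =
    \<lparr>hverts = pverts T,
     hedges = {X. X \<subseteq> pverts T \<and> card X = 3 \<and> is_cycle3 (with_proj T \<restriction> X)}\<rparr>"

definition realization :: "'a pair_pre_digraph \<Rightarrow> 'a hypergraph \<Rightarrow> bool" where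
  "realization T H \<longleftrightarrow> tournament T \<and> pverts T = hverts H \<and> H = C3_structure T"

definition realizable :: "'a hypergraph \<Rightarrow> bool" where
  "realizable H \<longleftrightarrow> (\<exists>T. realization T H)"


section \<open>Modules and strong modules\<close>

definition hypergraph_module :: "'a hypergraph \<Rightarrow> 'a set \<Rightarrow> bool" where
  "hypergraph_module H M \<longleftrightarrow>
    M \<subseteq> hverts H \<and>
    (\<forall>e\<in>hedges H. e \<inter> M \<noteq> {} \<and> e - M \<noteq> {} \<longrightarrow>
      (\<exists>m\<in>M. e \<inter> M = {m} \<and> (\<forall>n\<in>M. (e - {m}) \<union> {n} \<in> hedges H)))"

definition tournament_module :: "'a pair_pre_digraph \<Rightarrow> 'a set \<Rightarrow> bool" where
  "tournament_module T M \<longleftrightarrow>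
    M \<subseteq> pverts T \<and>
    (\<forall>x\<in>M. \<forall>y\<in>M. \<forall>v\<in>pverts T. (x, v) \<in> parcs T \<and> (v, y) \<in> parcs T \<longrightarrow> v \<in> M)"

definition hypergraph_strong_module :: "'a hypergraph \<Rightarrow> 'a set \<Rightarrow> bool" where
  "hypergraph_strong_module H M \<longleftrightarrow>
    hypergraph_module H M \<and>
    (\<forall>N. hypergraph_module H N \<and> M \<inter> N \<noteq> {} \<longrightarrow> M \<subseteq> N \<or> N \<subseteq> M)"

definition tournament_strong_module :: "'a pair_pre_digraph \<Rightarrow> 'a set \<Rightarrow> bool" where
  "tournament_strong_module T M \<longleftrightarrow>
    tournament_module T M \<and>
    (\<forall>N. tournament_module T N \<and> M \<inter> N \<noteq> {} \<longrightarrow> M \<subseteq> N \<or> N \<subseteq> M)"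

end

theory Submission
  imports Defs
begin

text \<open>Every module of \<open>T\<close> is a module of \<open>H\<close>. Conversely let \<open>N\<close> be a module of \<open>H\<close>. A vertex \<open>s\<close>
  outside \<open>N\<close> that splits \<open>N\<close> (has both in- and out-neighbours in \<open>N\<close>) cuts \<open>N\<close> into its
  in-neighbours and its out-neighbours, and since no 3-cycle meets \<open>N\<close> in two vertices, all arcs go
  from the former to the latter. Adding all splitting vertices to \<open>N\<close> yields a module of \<open>T\<close>, and
  each \<open>s\<close> induces an ordered partition of this hull into two modules \<open>I \<rightarrow> K\<close> of \<open>T\<close> that
  refines its cut of \<open>N\<close>; \<open>s\<close> can be placed in either part.

  If \<open>N\<close> is strong in \<open>H\<close>, then such an \<open>I\<close> would overlap \<open>N\<close>, so nothing splits \<open>N\<close>. If \<open>M\<close> is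
  strong in \<open>T\<close> and meets \<open>N\<close>, then either \<open>M - N\<close> contains no splitting vertex and \<open>M\<close>, being
  comparable with the hull, is comparable with \<open>N\<close>, or \<open>M\<close> meets both \<open>I\<close> and \<open>K\<close> for a suitable
  placement of some \<open>s\<close>, and then \<open>N \<subseteq> I \<union> K \<subseteq> M\<close>.\<close>

section \<open>3-cycles of a tournament, and its modules as modules of the hypergraph\<close>

context tournament
begin

lemma arc_vertices:
  assumes "(u, v) \<in> parcs T"
  shows "u \<in> pverts T" "v \<in> pverts T"
  using assms by (auto dest: in_arcsD1 in_arcsD2)

lemma arc_neq: "(u, v) \<in> parcs T \<Longrightarrow> u \<noteq> v"
  using pair_no_loops[of "(u, v)"] by auto

lemma arc_antisym: "(u, v) \<in> parcs T \<Longrightarrow> (v, u) \<notin> parcs T"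
  using exactly_one_arc[of u v] arc_vertices arc_neq by blast

lemma arc_total:
  "u \<in> pverts T \<Longrightarrow> v \<in> pverts T \<Longrightarrow> u \<noteq> v \<Longrightarrow> (v, u) \<notin> parcs T \<Longrightarrow> (u, v) \<in> parcs T"
  using exactly_one_arc[of u v] by blast

lemma is_cycle3_restrict_iff:
  "X \<subseteq> pverts T \<and> card X = 3 \<and> is_cycle3 (with_proj T \<restriction> X) \<longleftrightarrow>
    (\<exists>x y z. X = {x, y, z} \<and> (x, y) \<in> parcs T \<and> (y, z) \<in> parcs T \<and> (z, x) \<in> parcs T)"
    (is "?L \<longleftrightarrow> ?R")
proof
  assume ?L
  then obtain f where f: "pre_digraph.digraph_isomorphism (with_proj T \<restriction> X) f"
      and std: "with_proj std_cycle3 = app_iso f (with_proj T \<restriction> X)"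
    unfolding is_cycle3_def digraph_iso_def by blast
  have verts: "iso_verts f ` X = {0, 1, 2}"
    and arcs: "iso_arcs f ` {e \<in> parcs T. fst e \<in> X \<and> snd e \<in> X} = {(0, 1), (1, 2), (2, 0)}"
    and tail: "iso_tail f = fst" and head: "iso_head f = snd"
    using arg_cong[OF std, of verts] arg_cong[OF std, of arcs]
      arg_cong[OF std, of tail] arg_cong[OF std, of head]
    by (simp_all add: std_cycle3_def)
  have inj: "inj_on (iso_verts f) X"
    and ends: "\<And>e. e \<in> parcs T \<Longrightarrow> fst e \<in> X \<Longrightarrow> snd e \<in> X \<Longrightarrow>
      iso_verts f (fst e) = fst (iso_arcs f e) \<and> iso_verts f (snd e) = snd (iso_arcs f e)"
    using f unfolding pre_digraph.digraph_isomorphism_def by (auto simp: tail head)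
  obtain x y z where xyz: "x \<in> X" "y \<in> X" "z \<in> X"
      "iso_verts f x = 0" "iso_verts f y = 1" "iso_verts f z = 2"
  proof -
    have "0 \<in> iso_verts f ` X" "1 \<in> iso_verts f ` X" "2 \<in> iso_verts f ` X"
      by (simp_all add: verts)
    then show thesis using that by (elim imageE) metis
  qed
  \<comment> \<open>An isomorphism carries an arc map besides its vertex map. The arc is taken from
    the preimage under \<open>iso_arcs f\<close>; its ends are \<open>u\<close> and \<open>v\<close>
    because \<open>iso_verts f\<close> is injective on \<open>X\<close>.\<close>
  have pull_back: "(u, v) \<in> parcs T"
    if uv: "u \<in> X" "v \<in> X" "(iso_verts f u, iso_verts f v) \<in> {(0, 1), (1, 2), (2, 0)}" for u v
  proof -
    obtain e where e: "e \<in> parcs T" "fst e \<in> X" "snd e \<in> X"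
        "iso_arcs f e = (iso_verts f u, iso_verts f v)"
      using arcs uv(3) by (smt (verit, best) imageE mem_Collect_eq)
    then have "fst e = u" "snd e = v"
      using ends[of e] inj uv by (auto dest: inj_onD)
    with e show ?thesis by auto
  qed
  have "iso_verts f ` X = iso_verts f ` {x, y, z}"
    using verts xyz by auto
  then have "X = {x, y, z}"
    using inj_on_image_eq_iff[OF inj, of X "{x, y, z}"] xyz(1-3) by simp
  moreover have "(x, y) \<in> parcs T" "(y, z) \<in> parcs T" "(z, x) \<in> parcs T"
    by (simp_all add: pull_back xyz)
  ultimately show ?R by blast
next
  assume ?R
  then obtain x y z where X: "X = {x, y, z}"
    and arcs: "(x, y) \<in> parcs T" "(y, z) \<in> parcs T" "(z, x) \<in> parcs T"
    by blast
  have neq: "x \<noteq> y" "y \<noteq> z" "z \<noteq> x" using arcs arc_neq by auto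
  have restricted: "{e \<in> parcs T. fst e \<in> X \<and> snd e \<in> X} = {(x, y), (y, z), (z, x)}"
  proof -
    have "(y, x) \<notin> parcs T" "(z, y) \<notin> parcs T" "(x, z) \<notin> parcs T" "\<And>u. (u, u) \<notin> parcs T"
      using arcs arc_antisym arc_neq by blast+
    then show ?thesis using arcs unfolding X by auto
  qed
  define g where "g = (\<lambda>u. if u = x then 0 else if u = y then 1 else 2::nat)"
  define f where
    "f = \<lparr>iso_verts = g, iso_arcs = map_prod g g, iso_head = snd, iso_tail = fst\<rparr>"
  have "inj_on (map_prod g g) {(x, y), (y, z), (z, x)}"
    using neq by (auto simp: g_def)
  moreover have "inj_on g X" using neq by (auto simp: g_def X)
  moreover have "wf_digraph (with_proj T \<restriction> X)"
    by unfold_locales auto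
  ultimately have "pre_digraph.digraph_isomorphism (with_proj T \<restriction> X) f"
    unfolding pre_digraph.digraph_isomorphism_def by (simp add: f_def restricted)
  moreover have "with_proj std_cycle3 = app_iso f (with_proj T \<restriction> X)"
    unfolding app_iso_def with_proj_def[of std_cycle3] using neq
    by (simp add: f_def restricted std_cycle3_def) (auto simp: g_def X)
  ultimately have "is_cycle3 (with_proj T \<restriction> X)"
    unfolding is_cycle3_def digraph_iso_def by blast
  then show ?L using X neq arcs arc_vertices by auto
qed

lemma hverts_C3_structure: "hverts (C3_structure T) = pverts T"
  by (simp add: C3_structure_def)

lemma hedges_C3_structure:
  "e \<in> hedges (C3_structure T) \<longleftrightarrow>
    (\<exists>x y z. e = {x, y, z} \<and> (x, y) \<in> parcs T \<and> (y, z) \<in> parcs T \<and> (z, x) \<in> parcs T)"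
  using is_cycle3_restrict_iff[of e] by (simp add: C3_structure_def)

lemma converse_tournament: "tournament \<lparr>pverts = pverts T, parcs = (parcs T)\<inverse>\<rparr>"
  using pair_finite_verts pair_finite_arcs
  by unfold_locales (auto dest: arc_vertices arc_neq arc_antisym intro: arc_total)

lemma tournament_module_converse:
  "tournament_module \<lparr>pverts = pverts T, parcs = (parcs T)\<inverse>\<rparr> M \<longleftrightarrow> tournament_module T M"
  unfolding tournament_module_def by auto

lemma hypergraph_module_if_tournament_module:
  assumes M: "tournament_module T M"
  shows "hypergraph_module (C3_structure T) M"
  unfolding hypergraph_module_def hverts_C3_structure
proof (intro conjI ballI impI)
  show "M \<subseteq> pverts T" using M by (simp add: tournament_module_def)
next
  fix e assume e: "e \<in> hedges (C3_structure T)" and meet: "e \<inter> M \<noteq> {} \<and> e - M \<noteq> {}"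
  have closed: "\<And>x y v. x \<in> M \<Longrightarrow> y \<in> M \<Longrightarrow> (x, v) \<in> parcs T \<Longrightarrow> (v, y) \<in> parcs T \<Longrightarrow> v \<in> M"
    using M arc_vertices unfolding tournament_module_def by blast
  obtain m where "m \<in> e" "m \<in> M" using meet by blast
  with e obtain v w where e_eq: "e = {m, v, w}"
    and arcs: "(m, v) \<in> parcs T" "(v, w) \<in> parcs T" "(w, m) \<in> parcs T"
    unfolding hedges_C3_structure by blast
  \<comment> \<open>If one of \<open>v\<close>, \<open>w\<close> lay in \<open>M\<close>, closure
    under paths along the cycle would put the other there too, leaving nothing of \<open>e\<close>
    outside \<open>M\<close>.\<close>
  have out: "v \<notin> M" "w \<notin> M"
    using closed[of m m] closed[of v m w] closed[of m w v] meet \<open>m \<in> M\<close> arcs e_eq by blast+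
  show "\<exists>m\<in>M. e \<inter> M = {m} \<and> (\<forall>n\<in>M. e - {m} \<union> {n} \<in> hedges (C3_structure T))"
  proof (intro bexI[of _ m] conjI ballI)
    show "e \<inter> M = {m}" using e_eq out \<open>m \<in> M\<close> by blast
    fix n assume "n \<in> M"
    have "n \<in> pverts T" using \<open>n \<in> M\<close> M by (auto simp: tournament_module_def)
    \<comment> \<open>A reversed arc would put \<open>v\<close> or \<open>w\<close> between
      \<open>m\<close> and \<open>n\<close>, hence into \<open>M\<close>.\<close>
    have "(n, v) \<in> parcs T" "(w, n) \<in> parcs T"
      using closed[of m n v] closed[of n m w] out arcs \<open>m \<in> M\<close> \<open>n \<in> M\<close> \<open>n \<in> pverts T\<close>
        arc_total[of n v] arc_total[of w n] arc_vertices by blast+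
    moreover have "e - {m} \<union> {n} = {n, v, w}" using e_eq out \<open>m \<in> M\<close> by auto
    ultimately show "e - {m} \<union> {n} \<in> hedges (C3_structure T)"
      unfolding hedges_C3_structure using arcs by blast
  qed fact
qed

end

text \<open>What is used of a module of the hypergraph; unlike the definition, both conditions are visibly
  invariant under reversal of all arcs, which allows dual arguments.\<close>
locale cycle_module = tournament +
  fixes N :: "'a set"
  assumes module_subset: "N \<subseteq> pverts T"
    and no_cycle_two: "\<lbrakk>x \<in> N; y \<in> N; v \<notin> N; (v, x) \<in> parcs T; (x, y) \<in> parcs T\<rbrakk>
      \<Longrightarrow> (y, v) \<notin> parcs T"
    and cycle_swap: "\<lbrakk>m \<in> N; n \<in> N; v \<notin> N; w \<notin> N;
        (m, v) \<in> parcs T; (v, w) \<in> parcs T; (w, m) \<in> parcs T\<rbrakk>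
      \<Longrightarrow> (n, v) \<in> parcs T \<and> (w, n) \<in> parcs T"

lemma (in tournament) cycle_module_if_hypergraph_module:
  assumes N: "hypergraph_module (C3_structure T) N"
  shows "cycle_module T N"
proof
  show "N \<subseteq> pverts T"
    using N by (simp add: hypergraph_module_def hverts_C3_structure)
next
  fix x y v
  assume xyv: "x \<in> N" "y \<in> N" "v \<notin> N" "(v, x) \<in> parcs T" "(x, y) \<in> parcs T"
  show "(y, v) \<notin> parcs T"
  proof
    assume "(y, v) \<in> parcs T"
    with xyv have "{x, y, v} \<in> hedges (C3_structure T)"
      unfolding hedges_C3_structure by blast
    moreover have "{x, y, v} \<inter> N \<noteq> {} \<and> {x, y, v} - N \<noteq> {}" using xyv by blast
    ultimately obtain m where "{x, y, v} \<inter> N = {m}"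
      using N unfolding hypergraph_module_def by meson
    then have "x = y" using xyv(1,2) by (metis IntI insertCI singletonD)
    then show False using xyv(5) arc_neq by blast
  qed
next
  fix m n v w
  assume mn: "m \<in> N" "n \<in> N" "v \<notin> N" "w \<notin> N"
    and arcs: "(m, v) \<in> parcs T" "(v, w) \<in> parcs T" "(w, m) \<in> parcs T"
  then have "{m, v, w} \<in> hedges (C3_structure T)"
    unfolding hedges_C3_structure by blast
  moreover have "{m, v, w} \<inter> N \<noteq> {} \<and> {m, v, w} - N \<noteq> {}" using mn by blast
  ultimately obtain m' where m': "{m, v, w} \<inter> N = {m'}"
      "{m, v, w} - {m'} \<union> {n} \<in> hedges (C3_structure T)"
    using N mn(2) unfolding hypergraph_module_def by meson
  then have "m' = m" using mn by blast
  moreover have "{m, v, w} - {m} \<union> {n} = {n, v, w}" using mn by auto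
  ultimately obtain x y z where xyz: "{n, v, w} = {x, y, z}"
      "(x, y) \<in> parcs T" "(y, z) \<in> parcs T" "(z, x) \<in> parcs T"
    using m' unfolding hedges_C3_structure by auto
  moreover have "x \<noteq> y" "y \<noteq> z" "z \<noteq> x" using xyz arc_neq by blast+
  \<comment> \<open>The arc from \<open>v\<close> to \<open>w\<close> fixes the direction in which
    the cycle on \<open>n\<close>, \<open>v\<close>, \<open>w\<close> runs.\<close>
  moreover have "(w, v) \<notin> parcs T" using arcs arc_antisym by blast
  ultimately show "(n, v) \<in> parcs T \<and> (w, n) \<in> parcs T"
    by (smt (verit) insert_iff singletonD)
qed

section \<open>Splitting vertices, their hull and its cuts\<close>

context cycle_module
begin

definition splits :: "'a \<Rightarrow> bool" where
  "splits s \<longleftrightarrow> s \<in> pverts T - N \<and> (\<exists>x\<in>N. (x, s) \<in> parcs T) \<and> (\<exists>y\<in>N. (s, y) \<in> parcs T)"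

definition split_hull :: "'a set" where
  "split_hull = N \<union> {s. splits s}"

lemma converse_cycle_module: "cycle_module \<lparr>pverts = pverts T, parcs = (parcs T)\<inverse>\<rparr> N"
  (is "cycle_module ?T' N")
proof -
  interpret rev: tournament ?T'
    by (rule converse_tournament)
  show ?thesis
  proof
    show "N \<subseteq> pverts ?T'"
      using module_subset by simp
  next
    fix x y v
    assume "x \<in> N" "y \<in> N" "v \<notin> N" "(v, x) \<in> parcs ?T'" "(x, y) \<in> parcs ?T'"
    then show "(y, v) \<notin> parcs ?T'"
      using no_cycle_two[of y x v] by auto
  next
    fix m n v w
    assume "m \<in> N" "n \<in> N" "v \<notin> N" "w \<notin> N"
      "(m, v) \<in> parcs ?T'" "(v, w) \<in> parcs ?T'" "(w, m) \<in> parcs ?T'"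
    then show "(n, v) \<in> parcs ?T' \<and> (w, n) \<in> parcs ?T'"
      using cycle_swap[of m n w v] by auto
  qed
qed

lemma in_out_cases:
  assumes "x \<in> N" "s \<in> pverts T" "s \<notin> N"
  shows "(x, s) \<in> parcs T \<or> (s, x) \<in> parcs T"
  using assms module_subset arc_total[of x s] by blast

lemma in_to_out:
  assumes "x \<in> N" "y \<in> N" "s \<notin> N" "(x, s) \<in> parcs T" "(s, y) \<in> parcs T"
  shows "(x, y) \<in> parcs T"
proof -
  have "x \<noteq> y" using assms arc_antisym by blast
  then show ?thesis
    using assms no_cycle_two[of y x s] module_subset arc_total[of x y] by blast
qed

lemma no_splits_imp_tournament_module:
  assumes "\<And>s. \<not> splits s"
  shows "tournament_module T N"
  using assms module_subset unfolding tournament_module_def splits_def by blast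

lemma outside_hull_cases:
  assumes "w \<in> pverts T" "w \<notin> split_hull"
  shows "(\<forall>x\<in>N. (x, w) \<in> parcs T) \<or> (\<forall>x\<in>N. (w, x) \<in> parcs T)"
proof -
  have "w \<notin> N" "\<not> splits w" using assms unfolding split_hull_def by blast+
  then show ?thesis using assms(1) in_out_cases[of _ w] unfolding splits_def by blast
qed

text \<open>Otherwise \<open>w\<close> has an arc to \<open>s\<close>, and \<open>s\<close>,
  \<open>w\<close> form a cycle with an out-neighbour of \<open>s\<close> in \<open>N\<close>.
  Swapping that vertex for an in-neighbour of \<open>s\<close> reverses the arc between the latter
  and \<open>s\<close>.\<close>

lemma splits_dominated:
  assumes "splits s" "w \<notin> N" "w \<in> pverts T" "\<forall>x\<in>N. (x, w) \<in> parcs T"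
  shows "(s, w) \<in> parcs T"
proof (rule ccontr)
  assume no: "(s, w) \<notin> parcs T"
  obtain x y where xy: "x \<in> N" "y \<in> N" "(x, s) \<in> parcs T" "(s, y) \<in> parcs T"
      "s \<notin> N" "s \<in> pverts T"
    using assms(1) unfolding splits_def by blast
  have "s \<noteq> w" using xy assms(4) arc_antisym by blast
  then have "(w, s) \<in> parcs T" using no xy assms(3) arc_total by blast
  then have "(x, w) \<in> parcs T \<and> (s, x) \<in> parcs T"
    using cycle_swap[of y x w s] xy assms by blast
  then show False using xy arc_antisym by blast
qed

lemma splits_dominating:
  assumes "splits s" "w \<notin> N" "w \<in> pverts T" "\<forall>x\<in>N. (w, x) \<in> parcs T"
  shows "(w, s) \<in> parcs T"
proof -
  let ?T' = "\<lparr>pverts = pverts T, parcs = (parcs T)\<inverse>\<rparr>"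
  interpret rev: cycle_module ?T' N by (rule converse_cycle_module)
  have "rev.splits s" using assms(1) unfolding splits_def rev.splits_def by auto
  then show ?thesis using rev.splits_dominated[of s w] assms by auto
qed

text \<open>A vertex outside the hull does not split \<open>N\<close>, and the two preceding lemmas
  extend its uniform direction from \<open>N\<close> to the splitting vertices.\<close>

lemma tournament_module_hull: "tournament_module T split_hull"
proof -
  have "(\<forall>x\<in>split_hull. (x, w) \<in> parcs T) \<or> (\<forall>x\<in>split_hull. (w, x) \<in> parcs T)"
    if "w \<in> pverts T" "w \<notin> split_hull" for w
    using outside_hull_cases[OF that] splits_dominated[of _ w] splits_dominating[of _ w] that
    unfolding split_hull_def by blast
  moreover have "split_hull \<subseteq> pverts T" using module_subset unfolding split_hull_def splits_def by blast
  ultimately show ?thesis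
    unfolding tournament_module_def using arc_antisym by blast
qed

text \<open>A path of length two with both ends in one part stays in the hull, and its midpoint
  cannot lie in the other part, since all arcs between the parts run one way.\<close>

lemma tournament_module_hull_part:
  assumes "I \<union> K = split_hull" and "\<And>x y. x \<in> I \<Longrightarrow> y \<in> K \<Longrightarrow> (x, y) \<in> parcs T"
  shows "tournament_module T I" "tournament_module T K"
proof -
  have "v \<in> split_hull" if "x \<in> split_hull" "y \<in> split_hull" "(x, v) \<in> parcs T" "(v, y) \<in> parcs T" for x y v
    using tournament_module_hull that arc_vertices unfolding tournament_module_def by blast
  moreover have "split_hull \<subseteq> pverts T" using tournament_module_hull by (simp add: tournament_module_def)
  ultimately show "tournament_module T I" "tournament_module T K"
    unfolding tournament_module_def using assms arc_antisym by blast+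
qed

lemma cut_modules:
  assumes s: "splits s"
  obtains I K where "tournament_module T I" "tournament_module T K" "I \<union> K = split_hull" "I \<inter> K = {}"
    "s \<in> I" "\<And>x. x \<in> N \<Longrightarrow> (x, s) \<in> parcs T \<Longrightarrow> x \<in> I" "\<And>y. y \<in> N \<Longrightarrow> (s, y) \<in> parcs T \<Longrightarrow> y \<in> K"
proof -
  define J where "J = {x \<in> N. (x, s) \<in> parcs T}"
  \<comment> \<open>A splitting vertex goes to \<open>I\<close> when its own cut of \<open>N\<close>
    lies no later than that of \<open>s\<close>. The in-neighbours of \<open>s\<close> in
    \<open>N\<close> are exactly \<open>J\<close>, so \<open>s\<close> itself falls into
    \<open>I\<close>.\<close>
  define I where "I = J \<union> {t. splits t \<and> (\<forall>x\<in>N. (x, t) \<in> parcs T \<longrightarrow> x \<in> J)}"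
  define K where "K = split_hull - I"
  have s': "s \<notin> N" "s \<in> pverts T" using s by (auto simp: splits_def)
  have K_iff: "k \<in> K \<longleftrightarrow> k \<in> N \<and> k \<notin> J \<or>
      splits k \<and> (\<exists>x\<in>N. (x, k) \<in> parcs T \<and> x \<notin> J)" for k
    unfolding K_def I_def split_hull_def J_def by (auto simp: splits_def)
  have JN: "(x, y) \<in> parcs T" if "x \<in> J" "y \<in> N" "y \<notin> J" for x y
    using that in_to_out[of x y s] in_out_cases[of y s] s' unfolding J_def by blast
  \<comment> \<open>An arc from \<open>t\<close> to \<open>x\<close> would make \<open>y\<close> an
    in-neighbour and \<open>x\<close> an out-neighbour of \<open>t\<close>, forcing an arc from
    \<open>y\<close> to \<open>x\<close> against \<open>JN\<close>.\<close>
  have JS: "(x, t) \<in> parcs T" if "x \<in> J" "splits t" "y \<in> N" "(y, t) \<in> parcs T" "y \<notin> J" for x y t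
  proof (rule ccontr)
    assume no: "(x, t) \<notin> parcs T"
    have x: "x \<in> N" and t: "t \<notin> N" "t \<in> pverts T" using that by (auto simp: J_def splits_def)
    then have "(y, x) \<in> parcs T" using no in_out_cases[of x t] in_to_out[of y x t] that by blast
    then show False using JN[of x y] that arc_antisym by blast
  qed
  have "(u, v) \<in> parcs T" if u: "u \<in> I" and v: "v \<in> K" for u v
  proof (cases "u \<in> J")
    case True
    then show ?thesis using v K_iff JN JS by blast
  next
    case False
    then have su: "splits u" and in_J: "\<And>x. x \<in> N \<Longrightarrow> (x, u) \<in> parcs T \<Longrightarrow> x \<in> J"
      using u unfolding I_def by blast+
    have u': "u \<notin> N" "u \<in> pverts T" using su by (auto simp: splits_def)
    show ?thesis
    proof (cases "v \<in> N")
      case True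
      then have "v \<notin> J" using v unfolding K_def I_def by blast
      then show ?thesis using in_J in_out_cases[of v u] u' True by blast
    next
      case False
      then obtain x where sv: "splits v" and x: "x \<in> N" "(x, v) \<in> parcs T" "x \<notin> J"
        using v K_iff by blast
      have ux: "(u, x) \<in> parcs T" using x in_J in_out_cases[of x u] u' by blast
      show ?thesis
      proof (rule ccontr)
        assume no: "(u, v) \<notin> parcs T"
        have v': "v \<in> pverts T" "u \<noteq> v"
          using sv x(2) ux arc_antisym by (auto simp: splits_def)
        then have vu: "(v, u) \<in> parcs T" using no u' arc_total by blast
        obtain y where y: "y \<in> N" "(y, u) \<in> parcs T" using su by (auto simp: splits_def)
        \<comment> \<open>The cycle through \<open>x\<close>, \<open>v\<close>, \<open>u\<close>
          meets \<open>N\<close> only in \<open>x\<close>; swapping \<open>x\<close> for the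
          in-neighbour \<open>y\<close> of \<open>u\<close> reverses the arc between
          \<open>y\<close> and \<open>u\<close>.\<close>
        have "(u, y) \<in> parcs T"
          using cycle_swap[of x y v u] x y ux vu False u' by blast
        then show False using y arc_antisym by blast
      qed
    qed
  qed
  moreover have "I \<subseteq> split_hull" unfolding I_def split_hull_def J_def by blast
  then have "I \<union> K = split_hull" unfolding K_def by blast
  ultimately have "tournament_module T I" "tournament_module T K"
    using tournament_module_hull_part by blast+
  moreover have "s \<in> I" using s unfolding I_def J_def by blast
  moreover have "x \<in> I" if "x \<in> N" "(x, s) \<in> parcs T" for x
    using that unfolding I_def J_def by blast
  moreover have "y \<in> K" if "y \<in> N" "(s, y) \<in> parcs T" for y
    using that arc_antisym unfolding K_iff J_def by blast
  ultimately show thesis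
    using that[of I K] \<open>I \<union> K = split_hull\<close> unfolding K_def by blast
qed

text \<open>The cut at \<open>s\<close> separates \<open>s\<close> from its out-neighbours in \<open>N\<close>.\<close>
lemma tournament_strong_module_covers:
  assumes M: "tournament_strong_module T M" and s: "splits s" "s \<in> M"
    and y: "y \<in> N" "y \<in> M" "(s, y) \<in> parcs T"
  shows "N \<subseteq> M"
proof -
  obtain I K where IK: "tournament_module T I" "tournament_module T K" "I \<union> K = split_hull" "I \<inter> K = {}"
      "s \<in> I" "y \<in> K"
    using cut_modules[OF s(1)] y by metis
  then have "I \<subseteq> M" "K \<subseteq> M"
    using M s y unfolding tournament_strong_module_def by blast+
  then show ?thesis using IK unfolding split_hull_def by blast
qed

lemma tournament_strong_module_comparable:
  assumes M: "tournament_strong_module T M" and meet: "M \<inter> N \<noteq> {}"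
  shows "M \<subseteq> N \<or> N \<subseteq> M"
proof (cases "\<exists>s\<in>M. splits s")
  case True
  then obtain s y where s: "s \<in> M" "splits s" and y: "y \<in> M" "y \<in> N" using meet by blast
  then have "(y, s) \<in> parcs T \<or> (s, y) \<in> parcs T"
    using in_out_cases unfolding splits_def by blast
  then show ?thesis
  proof
    assume "(s, y) \<in> parcs T"
    then show ?thesis using tournament_strong_module_covers M s y by blast
  next
    assume "(y, s) \<in> parcs T"
    \<comment> \<open>Reversing all arcs makes \<open>y\<close> an out-neighbour of
      \<open>s\<close>. In terms of \<open>T\<close>, the cut now has \<open>s\<close> on the side
      of its out-neighbours, so \<open>M\<close> again meets both parts.\<close>
    let ?T' = "\<lparr>pverts = pverts T, parcs = (parcs T)\<inverse>\<rparr>"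
    interpret rev: cycle_module ?T' N by (rule converse_cycle_module)
    have "tournament_strong_module ?T' M"
      using M by (simp add: tournament_strong_module_def tournament_module_converse)
    moreover have "rev.splits s" using s unfolding splits_def rev.splits_def by auto
    ultimately show ?thesis
      using rev.tournament_strong_module_covers[of M s y] s y \<open>(y, s) \<in> parcs T\<close> by auto
  qed
next
  case False
  have "M \<subseteq> split_hull \<or> split_hull \<subseteq> M"
    using M meet tournament_module_hull unfolding tournament_strong_module_def split_hull_def by blast
  then show ?thesis using False unfolding split_hull_def by blast
qed

end

section \<open>Strong modules of the hypergraph, and the equivalence\<close>

lemma (in tournament) tournament_module_if_hypergraph_strong_module:
  assumes M: "hypergraph_strong_module (C3_structure T) M"
  shows "tournament_module T M"
proof -
  interpret cycle_module T M
    using M by (simp add: hypergraph_strong_module_def cycle_module_if_hypergraph_module)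
  have "\<not> splits s" for s
  proof
    assume s: "splits s"
    then obtain x y where xy: "x \<in> M" "y \<in> M" "(x, s) \<in> parcs T" "(s, y) \<in> parcs T" "s \<notin> M"
      unfolding splits_def by blast
    \<comment> \<open>\<open>I\<close> and \<open>M\<close> overlap: \<open>x\<close> is common,
      \<open>s\<close> lies only in \<open>I\<close>, and \<open>y\<close> only in
      \<open>M\<close>.\<close>
    obtain I where I: "tournament_module T I" "s \<in> I" "x \<in> I" "y \<notin> I"
      using cut_modules[OF s] xy by (metis disjoint_iff)
    then have "M \<subseteq> I \<or> I \<subseteq> M"
      using M xy hypergraph_module_if_tournament_module[of I]
      unfolding hypergraph_strong_module_def by blast
    then show False using I xy by blast
  qed
  then show ?thesis by (rule no_splits_imp_tournament_module)
qed

theorem theorem10: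
  fixes H :: "'a hypergraph" and T :: "'a pair_pre_digraph" and M :: "'a set"
  assumes "uniform3_hypergraph H"
    and "realizable H"
    and "realization T H"
    and "M \<subseteq> hverts H"
  shows "hypergraph_strong_module H M \<longleftrightarrow> tournament_strong_module T M"
proof -
  interpret tournament T using assms(3) by (simp add: realization_def)
  have H: "H = C3_structure T" using assms(3) by (simp add: realization_def)
  show ?thesis
  proof
    assume "hypergraph_strong_module H M"
    then show "tournament_strong_module T M"
      using tournament_module_if_hypergraph_strong_module hypergraph_module_if_tournament_module
      unfolding H tournament_strong_module_def hypergraph_strong_module_def by blast
  next
    assume M: "tournament_strong_module T M"
    have "M \<subseteq> N \<or> N \<subseteq> M" if "hypergraph_module H N" "M \<inter> N \<noteq> {}" for N
      using cycle_module.tournament_strong_module_comparable[of T N M]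
        cycle_module_if_hypergraph_module that M unfolding H by blast
    then show "hypergraph_strong_module H M"
      using M hypergraph_module_if_tournament_module
      unfolding H tournament_strong_module_def hypergraph_strong_module_def by blast
  qed
qed

end
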